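(* Let $d\ge 1$ and let $\Phi: M_d(\mathbb{C})\to M_d(\mathbb{C})$ be a completely positive linear map. Then $\Phi$ can be written in the form $$\Phi(\rho)=\sum_k R_k\,\mathrm{Tr}(F_k\rho)\qquad (\text{finite sum})$$ with each $R_k$ a density matrix and each $F_k$ a positive semi-definite operator if and only if $\Phi$ is entanglement breaking. Moreover, for a map written in this form, $\Phi$ is trace-preserving if and only if $\{F_k\}$ is a POVM, i.e. $\sum_k F_k=I$; equivalently, when such a map is written in the form $\Phi(\rho)=\sum_k|\psi_k\rangle\langle\psi_k|\,\langle\phi_k,\rho\,\phi_k\rangle$ with unit vectors $\psi_k\in\mathbb{C}^d$ and vectors $\phi_k\in\mathbb{C}^d$, $\Phi$ is trace-preserving if and only if $\sum_k|\phi_k\rangle\langle\phi_k|=I$.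
   Context: $M_d(\mathbb{C})$ is the algebra of complex $d\times d$ matrices. A density matrix is a positive semi-definite matrix of trace one. A POVM is a finite family $\{F_k\}$ of positive semi-definite matrices with $\sum_kF_k=I$. A positive semi-definite operator on a tensor product of two finite-dimensional Hilbert spaces is separable if it is a finite sum $\sum_i P_i\otimes Q_i$ with all $P_i,Q_i$ positive semi-definite (for a density matrix: a convex combination of products of density matrices); a density matrix that is not separable is entangled. A completely positive map $\Phi$ on $M_d(\mathbb{C})$ is entanglement breaking if $(I\otimes\Phi)(\Gamma)$ is separable for every density matrix $\Gamma$ on $\mathbb{C}^n\otimes\mathbb{C}^d$ and every $n\ge1$ (here $I$ is the identity map on $M_n(\mathbb{C})$). *)

theory Defs
  imports "Jordan_Normal_Form.Matrix"
begin

text \<open>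
  M_d(C) is rendered as \<^term>\<open>carrier_mat d d :: complex mat set\<close>, so that the size n of the
  ancilla system can be quantified over inside definitions. Maps on M_d(C) are HOL functions
  of which only the values on this carrier matter. Finite families are indexed by
  k < m, where m = 0 (the empty family) is allowed.
\<close>

definition mat_family_sum :: "nat \<Rightarrow> nat \<Rightarrow> (nat \<Rightarrow> complex mat) \<Rightarrow> complex mat" where
  "mat_family_sum d m A = mat d d (\<lambda>(i, j). \<Sum>k<m. A k $$ (i, j))"

definition mat_trace :: "complex mat \<Rightarrow> complex" where
  "mat_trace A = (\<Sum>i<dim_row A. A $$ (i, i))"

text \<open>
  The order on \<^typ>\<open>complex\<close> is the one of \<^theory>\<open>HOL-Library.Complex_Order\<close>: 0 \<le> z means that z
  is real and nonnegative. Hence the condition below includes that A is Hermitian.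
\<close>

definition psd :: "nat \<Rightarrow> complex mat \<Rightarrow> bool" where
  "psd d A \<longleftrightarrow> A \<in> carrier_mat d d \<and> (\<forall>v \<in> carrier_vec d. 0 \<le> (A *\<^sub>v v) \<bullet>c v)"

definition density_matrix :: "nat \<Rightarrow> complex mat \<Rightarrow> bool" where
  "density_matrix d A \<longleftrightarrow> psd d A \<and> mat_trace A = 1"

definition povm :: "nat \<Rightarrow> nat \<Rightarrow> (nat \<Rightarrow> complex mat) \<Rightarrow> bool" where
  "povm d m F \<longleftrightarrow> (\<forall>k<m. psd d (F k)) \<and> mat_family_sum d m F = 1\<^sub>m d"

text \<open>
  The tensor product of C^n and C^d is identified with C^(n * d) by sending
  the product of the basis vectors with numbers a and b to the basis vector with number a * d + b.
\<close>

definition kron :: "complex mat \<Rightarrow> complex mat \<Rightarrow> complex mat" where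
  "kron A B = mat (dim_row A * dim_row B) (dim_col A * dim_col B)
     (\<lambda>(i, j). A $$ (i div dim_row B, j div dim_col B) * B $$ (i mod dim_row B, j mod dim_col B))"

definition separable :: "nat \<Rightarrow> nat \<Rightarrow> complex mat \<Rightarrow> bool" where
  "separable n d A \<longleftrightarrow>
     (\<exists>m P Q. (\<forall>k<m. psd n (P k) \<and> psd d (Q k)) \<and>
        A = mat_family_sum (n * d) m (\<lambda>k. kron (P k) (Q k)))"

definition linear_map :: "nat \<Rightarrow> (complex mat \<Rightarrow> complex mat) \<Rightarrow> bool" where
  "linear_map d \<Phi> \<longleftrightarrow>
     (\<forall>A \<in> carrier_mat d d. \<Phi> A \<in> carrier_mat d d) \<and>
     (\<forall>A \<in> carrier_mat d d. \<forall>B \<in> carrier_mat d d. \<Phi> (A + B) = \<Phi> A + \<Phi> B) \<and>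
     (\<forall>c. \<forall>A \<in> carrier_mat d d. \<Phi> (c \<cdot>\<^sub>m A) = c \<cdot>\<^sub>m \<Phi> A)"

text \<open>The (a, b) block, of size d by d, of an (n * d) by (n * d) matrix.\<close>

definition mat_block :: "nat \<Rightarrow> complex mat \<Rightarrow> nat \<Rightarrow> nat \<Rightarrow> complex mat" where
  "mat_block d X a b = mat d d (\<lambda>(k, l). X $$ (a * d + k, b * d + l))"

text \<open>
  The map that acts as the identity on M_n(C) tensored with \<open>\<Phi>\<close>: it applies \<open>\<Phi>\<close> to each
  d by d block. Lemma \<open>ampliation_kron\<close> below confirms its action on product matrices.
\<close>

definition ampliation ::
  "nat \<Rightarrow> nat \<Rightarrow> (complex mat \<Rightarrow> complex mat) \<Rightarrow> complex mat \<Rightarrow> complex mat" where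
  "ampliation n d \<Phi> X = mat (n * d) (n * d)
     (\<lambda>(i, j). \<Phi> (mat_block d X (i div d) (j div d)) $$ (i mod d, j mod d))"

lemma ampliation_kron:
  assumes \<Phi>: "linear_map d \<Phi>" and A: "A \<in> carrier_mat n n" and B: "B \<in> carrier_mat d d"
  shows "ampliation n d \<Phi> (kron A B) = kron A (\<Phi> B)"
proof -
  have \<Phi>B: "\<Phi> B \<in> carrier_mat d d"
    using \<Phi> B by (simp add: linear_map_def)
  have idx: "a * d + k < n * d" if "a < n" "k < d" for a k
  proof -
    have "a * d + k < Suc a * d" using that by simp
    also have "\<dots> \<le> n * d" using that by (intro mult_right_mono) auto
    finally show ?thesis .
  qed
  have block: "mat_block d (kron A B) a b = A $$ (a, b) \<cdot>\<^sub>m B" if "a < n" "b < n" for a b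
    using A B that by (intro eq_matI) (auto simp: mat_block_def kron_def idx)
  show ?thesis
  proof (rule eq_matI)
    fix i j
    assume "i < dim_row (kron A (\<Phi> B))" "j < dim_col (kron A (\<Phi> B))"
    then have ij: "i < n * d" "j < n * d"
      using A \<Phi>B by (auto simp: kron_def)
    then have d: "0 < d"
      by (cases d) auto
    have q: "i div d < n" "j div d < n"
      using ij by (simp_all add: less_mult_imp_div_less)
    have "\<Phi> (A $$ (i div d, j div d) \<cdot>\<^sub>m B) = A $$ (i div d, j div d) \<cdot>\<^sub>m \<Phi> B"
      using \<Phi> B by (simp add: linear_map_def)
    then have "ampliation n d \<Phi> (kron A B) $$ (i, j) =
        A $$ (i div d, j div d) * \<Phi> B $$ (i mod d, j mod d)"
      using \<Phi>B ij q d by (simp add: ampliation_def block)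
    also have "\<dots> = kron A (\<Phi> B) $$ (i, j)"
      using A \<Phi>B ij by (simp add: kron_def)
    finally show "ampliation n d \<Phi> (kron A B) $$ (i, j) = kron A (\<Phi> B) $$ (i, j)" .
  qed (use A \<Phi>B in \<open>auto simp: ampliation_def kron_def\<close>)
qed

definition completely_positive :: "nat \<Rightarrow> (complex mat \<Rightarrow> complex mat) \<Rightarrow> bool" where
  "completely_positive d \<Phi> \<longleftrightarrow>
     linear_map d \<Phi> \<and> (\<forall>n\<ge>1. \<forall>X. psd (n * d) X \<longrightarrow> psd (n * d) (ampliation n d \<Phi> X))"

definition entanglement_breaking :: "nat \<Rightarrow> (complex mat \<Rightarrow> complex mat) \<Rightarrow> bool" where
  "entanglement_breaking d \<Phi> \<longleftrightarrow>
     (\<forall>n\<ge>1. \<forall>\<Gamma>. density_matrix (n * d) \<Gamma> \<longrightarrow> separable n d (ampliation n d \<Phi> \<Gamma>))"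

definition trace_preserving :: "nat \<Rightarrow> (complex mat \<Rightarrow> complex mat) \<Rightarrow> bool" where
  "trace_preserving d \<Phi> \<longleftrightarrow> (\<forall>\<rho> \<in> carrier_mat d d. mat_trace (\<Phi> \<rho>) = mat_trace \<rho>)"

definition holevo_form ::
  "nat \<Rightarrow> (complex mat \<Rightarrow> complex mat) \<Rightarrow> nat \<Rightarrow> (nat \<Rightarrow> complex mat) \<Rightarrow> (nat \<Rightarrow> complex mat) \<Rightarrow> bool"
where
  "holevo_form d \<Phi> m R F \<longleftrightarrow>
     (\<forall>k<m. density_matrix d (R k) \<and> psd d (F k)) \<and>
     (\<forall>\<rho> \<in> carrier_mat d d. \<Phi> \<rho> = mat_family_sum d m (\<lambda>k. mat_trace (F k * \<rho>) \<cdot>\<^sub>m R k))"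

text \<open>The rank-one matrix |v><v|.\<close>

definition ketbra :: "complex vec \<Rightarrow> complex mat" where
  "ketbra v = mat (dim_vec v) (dim_vec v) (\<lambda>(i, j). v $ i * cnj (v $ j))"

text \<open>
  \<^term>\<open>v \<bullet>c w\<close> is conjugate-linear in w, so the physicists' inner product of \<open>\<phi>\<close> with
  \<open>\<rho> \<phi>\<close> is \<open>(\<rho> *\<^sub>v \<phi>) \<bullet>c \<phi>\<close>.
\<close>

definition rank_one_form ::
  "nat \<Rightarrow> (complex mat \<Rightarrow> complex mat) \<Rightarrow> nat \<Rightarrow> (nat \<Rightarrow> complex vec) \<Rightarrow> (nat \<Rightarrow> complex vec) \<Rightarrow> bool"
where
  "rank_one_form d \<Phi> m \<psi> \<phi> \<longleftrightarrow>
     (\<forall>k<m. \<psi> k \<in> carrier_vec d \<and> \<psi> k \<bullet>c \<psi> k = 1 \<and> \<phi> k \<in> carrier_vec d) \<and>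
     (\<forall>\<rho> \<in> carrier_mat d d.
        \<Phi> \<rho> = mat_family_sum d m (\<lambda>k. ((\<rho> *\<^sub>v \<phi> k) \<bullet>c \<phi> k) \<cdot>\<^sub>m ketbra (\<psi> k)))"

end

theory Submission
  imports Defs
begin

text \<open>
  If \<open>\<Phi> \<rho> = \<Sum>\<^sub>k Tr(F\<^sub>k \<rho>) R\<^sub>k\<close>, then \<open>(I \<otimes> \<Phi>) \<Gamma> = \<Sum>\<^sub>k P\<^sub>k \<otimes> R\<^sub>k\<close> with \<open>P\<^sub>k\<close> the partial trace of
  \<open>(I \<otimes> F\<^sub>k) \<Gamma>\<close>; factoring \<open>F\<^sub>k\<close> into rank-one terms shows that \<open>P\<^sub>k\<close> is positive semi-definite.
  Conversely, the separable image \<open>\<Sum>\<^sub>k P\<^sub>k \<otimes> Q\<^sub>k\<close> of the maximally entangled state has the values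
  of \<open>\<Phi>\<close> on the matrix units as its blocks, up to the factor d, so that
  \<open>\<Phi> \<rho> = d \<Sum>\<^sub>k Tr(P\<^sub>k\<^sup>T \<rho>) Q\<^sub>k\<close>, and it remains to normalise the \<open>Q\<^sub>k\<close>. Finally, \<open>Tr(\<Phi> \<rho>)\<close> is
  \<open>Tr((\<Sum>\<^sub>k F\<^sub>k) \<rho>)\<close>, and matrices are determined by their trace pairings.
\<close>

section \<open>Reindexing of finite sums along tensor product indices\<close>

lemma sum_mult_index:
  fixes h :: "nat \<Rightarrow> 'a::comm_monoid_add"
  shows "(\<Sum>i<n * d. h i) = (\<Sum>a<n. \<Sum>k<d. h (a * d + k))"
proof -
  have "sum h {a * d..<a * d + d} = (\<Sum>k<d. h (a * d + k))" for a
    using sum.shift_bounds_nat_ivl[of h 0 "a * d" d]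
    by (simp add: lessThan_atLeast0 add.commute)
  then show ?thesis
    by (simp add: sum.nat_group[symmetric])
qed

lemma sum_rotate:
  "(\<Sum>i\<in>A. \<Sum>j\<in>B. \<Sum>k\<in>C. g i j k) = (\<Sum>k\<in>C. \<Sum>i\<in>A. \<Sum>j\<in>B. g i j k)"
proof -
  have "(\<Sum>i\<in>A. \<Sum>j\<in>B. \<Sum>k\<in>C. g i j k) = (\<Sum>i\<in>A. \<Sum>k\<in>C. \<Sum>j\<in>B. g i j k)"
    by (rule sum.cong[OF refl], rule sum.swap)
  then show ?thesis
    by (simp only: sum.swap[of _ C A])
qed

lemma mult_add_less:
  fixes a d k n :: nat
  assumes "a < n" "k < d"
  shows "a * d + k < n * d"
proof -
  have "a * d + k < Suc a * d" using assms by simp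
  also have "\<dots> \<le> n * d" using assms by (intro mult_right_mono) auto
  finally show ?thesis .
qed

section \<open>Quadratic forms and the factorization of positive semi-definite matrices\<close>

definition quad_form :: "nat \<Rightarrow> (nat \<Rightarrow> nat \<Rightarrow> complex) \<Rightarrow> (nat \<Rightarrow> complex) \<Rightarrow> complex" where
  "quad_form n f x = (\<Sum>i<n. \<Sum>j<n. f i j * x j * cnj (x i))"

text \<open>Positivity is moved to entry functions on the naturals so that the induction on the
  dimension can drop the last coordinate without cutting submatrices or shortening vectors.\<close>

lemma psd_iff_quad_form:
  "psd d A \<longleftrightarrow> A \<in> carrier_mat d d \<and> (\<forall>x. 0 \<le> quad_form d (\<lambda>i j. A $$ (i, j)) x)"
proof (cases "A \<in> carrier_mat d d")
  case True
  have eq: "(A *\<^sub>v v) \<bullet>c v = quad_form d (\<lambda>i j. A $$ (i, j)) (\<lambda>i. v $ i)"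
    if "v \<in> carrier_vec d" for v
    using True that
    by (auto simp: quad_form_def scalar_prod_def lessThan_atLeast0 sum_distrib_right
        intro!: sum.cong)
  have "0 \<le> quad_form d (\<lambda>i j. A $$ (i, j)) x" if "psd d A" for x
  proof -
    have "quad_form d (\<lambda>i j. A $$ (i, j)) x = (A *\<^sub>v vec d x) \<bullet>c vec d x"
      unfolding eq[OF vec_carrier] by (simp add: quad_form_def)
    then show ?thesis using that by (simp add: psd_def)
  qed
  then show ?thesis
    using True eq by (auto simp: psd_def)
qed (simp add: psd_def)

lemma quad_form_Suc:
  "quad_form (Suc n) f x = quad_form n f x + (\<Sum>i<n. f i n * cnj (x i)) * x n
    + (\<Sum>j<n. f n j * x j) * cnj (x n) + f n n * x n * cnj (x n)"
  by (simp add: quad_form_def sum.distrib sum_distrib_left sum_distrib_right ac_simps)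

lemma quad_form_point:
  assumes "i < n"
  shows "quad_form n f (\<lambda>k. if k = i then s else 0) = f i i * s * cnj s"
proof -
  have "quad_form n f (\<lambda>k. if k = i then s else 0) =
      (\<Sum>a<n. \<Sum>b<n. if b = i then if a = i then f i i * s * cnj s else 0 else 0)"
    unfolding quad_form_def by (intro sum.cong refl) auto
  then show ?thesis using assms by simp
qed

lemma quad_form_pair:
  assumes "i < n"
  shows "quad_form (Suc n) f (\<lambda>k. if k = i then s else if k = n then t else 0) =
    f i i * s * cnj s + f i n * cnj s * t + f n i * s * cnj t + f n n * t * cnj t"
proof -
  have a: "quad_form n f (\<lambda>k. if k = i then s else if k = n then t else 0) =
      quad_form n f (\<lambda>k. if k = i then s else 0)"
    unfolding quad_form_def by (intro sum.cong refl) auto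
  have b: "(\<Sum>k<n. f k n * cnj (if k = i then s else if k = n then t else 0)) =
      (\<Sum>k<n. if k = i then f i n * cnj s else 0)"
    by (intro sum.cong refl) auto
  have c: "(\<Sum>k<n. f n k * (if k = i then s else if k = n then t else 0)) =
      (\<Sum>k<n. if k = i then f n i * s else 0)"
    by (intro sum.cong refl) auto
  show ?thesis
    using assms unfolding quad_form_Suc a b c quad_form_point[OF assms] by simp
qed

lemma quad_form_nonneg_pair:
  assumes "\<And>x. 0 \<le> quad_form (Suc n) f x" and "i < n"
  shows "0 \<le> f i i * s * cnj s + f i n * cnj s * t + f n i * s * cnj t + f n n * t * cnj t"
  unfolding quad_form_pair[OF assms(2), symmetric] by (rule assms(1))

text \<open>The Hermitian symmetry is recovered by testing the form on \<open>e\<^sub>i + e\<^sub>n\<close> and \<open>e\<^sub>i + \<i> e\<^sub>n\<close>.\<close>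

lemma quad_form_nonneg_hermitian:
  assumes pos: "\<And>x. 0 \<le> quad_form (Suc n) f x" and "i < n"
  shows "f n i = cnj (f i n)"
proof -
  note q = quad_form_nonneg_pair[OF assms]
  have "Im (f i i) = 0" "Im (f n n) = 0"
    using q[of 1 0] q[of 0 1] by (simp_all add: less_eq_complex_def)
  then show ?thesis
    using q[of 1 1] q[of 1 \<i>] by (simp add: less_eq_complex_def complex_eq_iff)
qed

text \<open>With \<open>f n n = 0\<close> the form at \<open>e_i + t e_n\<close> is a constant plus
  a real-linear function of \<open>t\<close>, which is unbounded below unless its coefficient
  \<open>f i n\<close> vanishes.\<close>

lemma quad_form_nonneg_zero_diag:
  assumes pos: "\<And>x. 0 \<le> quad_form (Suc n) f x" and "i < n" and zero: "f n n = 0"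
  shows "f i n = 0"
proof (rule ccontr)
  assume nz: "f i n \<noteq> 0"
  define z where "z = f i n"
  \<comment> \<open>For \<open>t = - r * cnj z\<close> the form has real part
    \<open>Re (f i i) - 2 * r * (cmod z)\<^sup>2\<close>; this \<open>r\<close> makes it
    \<open>- Re (f i i) - 2\<close>, which is negative because \<open>f i i\<close> is
    nonnegative.\<close>
  define r where "r = (Re (f i i) + 1) / (cmod z)\<^sup>2"
  have herm: "f n i = cnj z"
    using quad_form_nonneg_hermitian[OF pos \<open>i < n\<close>] by (simp add: z_def)
  have "0 \<le> f i i * 1 * cnj 1 + f i n * cnj 1 * (- of_real r * cnj z)
      + f n i * 1 * cnj (- of_real r * cnj z) + f n n * (- of_real r * cnj z) * cnj (- of_real r * cnj z)"
    by (rule quad_form_nonneg_pair[OF pos \<open>i < n\<close>])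
  then have "0 \<le> Re (f i i) - 2 * r * (cmod z)\<^sup>2"
    by (simp add: herm zero less_eq_complex_def cmod_def power2_eq_square algebra_simps flip: z_def)
  moreover have "r * (cmod z)\<^sup>2 = Re (f i i) + 1"
    using nz by (simp add: r_def z_def)
  ultimately have "Re (f i i) < 0"
    by (simp add: algebra_simps)
  moreover have "0 \<le> f i i"
    using pos[of "\<lambda>k. if k = i then 1 else 0"] \<open>i < n\<close> by (simp add: quad_form_point)
  ultimately show False
    by (simp add: less_eq_complex_def)
qed

text \<open>
  Cholesky's argument: the Schur complement of the last diagonal entry is again positive
  semi-definite, because the last coordinate of the test vector can be chosen so as to minimise
  the form. If that entry is 0, so are the last row and column, and the division by 0 is harmless.
\<close>

lemma quad_form_nonneg_factorization:
  assumes "\<And>x. 0 \<le> quad_form n f x"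
  shows "\<exists>w. \<forall>i<n. \<forall>j<n. f i j = (\<Sum>r<n. w r i * cnj (w r j))"
  using assms
proof (induction n arbitrary: f)
  case 0
  then show ?case by simp
next
  case (Suc n)
  note pos = Suc.prems
  define g where "g i j = f i j - f i n * f n j / f n n" for i j
  have diag: "0 \<le> f n n"
    using pos[of "\<lambda>k. if k = n then 1 else 0"] by (simp add: quad_form_point)
  have "0 \<le> quad_form n g x" for x
  proof -
    define S where "S = (\<Sum>j<n. f n j * x j)"
    define T where "T = (\<Sum>i<n. f i n * cnj (x i))"
    define t where "t = - S / f n n"
    have "T * S / f n n = (\<Sum>i<n. \<Sum>j<n. f i n * f n j / f n n * x j * cnj (x i))"
      unfolding S_def T_def sum_product sum_divide_distrib by (intro sum.cong refl) simp
    then have "quad_form n g x = quad_form n f x - T * S / f n n"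
      by (simp add: quad_form_def g_def left_diff_distrib sum_subtractf)
    moreover have upd: "quad_form n f (x(n := t)) = quad_form n f x"
      unfolding quad_form_def by (intro sum.cong refl) auto
    moreover have "quad_form (Suc n) f (x(n := t)) =
        quad_form n f x + T * t + S * cnj t + f n n * t * cnj t"
      using upd by (simp add: quad_form_Suc S_def T_def)
    \<comment> \<open>The choice of \<open>t\<close> makes \<open>S + f n n * t\<close> vanish, so
      the last two terms cancel. If \<open>f n n = 0\<close>, then \<open>t = 0\<close> and both
      sides are 0 by the convention for division by 0.\<close>
    moreover have "T * t + S * cnj t + f n n * t * cnj t = - (T * S / f n n)"
      by (cases "f n n = 0") (simp_all add: t_def)
    ultimately have "quad_form n g x = quad_form (Suc n) f (x(n := t))"
      by (simp add: add.assoc)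
    then show ?thesis
      using pos by simp
  qed
  from Suc.IH[OF this] obtain w where
    w: "\<forall>i<n. \<forall>j<n. g i j = (\<Sum>r<n. w r i * cnj (w r j))" by blast
  define s where "s = complex_of_real (sqrt (Re (f n n)))"
  have s: "s * s = f n n" "cnj s = s"
    using diag by (auto simp: s_def less_eq_complex_def complex_eq_iff)
  \<comment> \<open>The new vector \<open>u n\<close> is the last column divided by the real root
    \<open>s\<close> of the pivot, so that it contributes exactly the rank-one term subtracted in
    \<open>g\<close>. The vectors for \<open>g\<close> are extended by 0 at coordinate
    \<open>n\<close>.\<close>
  define u where "u r i = (if r = n then f i n / s else if i = n then 0 else w r i)" for r i
  have herm: "f n j = cnj (f j n)" if "j < Suc n" for j
  proof (cases "j = n")
    case True
    then show ?thesis using diag by (auto simp: less_eq_complex_def complex_eq_iff)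
  next
    case False
    then show ?thesis using quad_form_nonneg_hermitian[OF pos, of j] that by simp
  qed
  have zero: "f j n = 0" if "f n n = 0" "j < Suc n" for j
  proof (cases "j = n")
    case False
    then show ?thesis using quad_form_nonneg_zero_diag[OF pos _ that(1), of j] that(2) by simp
  qed (use that in simp)
  have zero': "f n j = 0" if "f n n = 0" "j < Suc n" for j
    unfolding herm[OF that(2)] zero[OF that] by simp
  have "f i j = (\<Sum>r<Suc n. u r i * cnj (u r j))" if ij: "i < Suc n" "j < Suc n" for i j
  proof -
    have last: "u n i * cnj (u n j) = f i n * f n j / f n n"
      unfolding herm[OF ij(2)] by (simp add: u_def s)
    \<comment> \<open>The extension by 0 is right in the last row and column because the Schur
      complement vanishes there; elsewhere it is the factorization of \<open>g\<close>.\<close>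
    have "(\<Sum>r<n. u r i * cnj (u r j)) = f i j - f i n * f n j / f n n"
    proof (cases "i = n \<or> j = n")
      case True
      then have "(\<Sum>r<n. u r i * cnj (u r j)) = 0"
        by (auto simp: u_def)
      moreover have "f i j = f i n * f n j / f n n"
      proof (cases "f n n = 0")
        case z: True
        show ?thesis
          using True zero[OF z ij(1)] zero'[OF z ij(2)] by auto
      next
        case False
        then show ?thesis using True by auto
      qed
      ultimately show ?thesis by simp
    next
      case False
      then have "(\<Sum>r<n. u r i * cnj (u r j)) = (\<Sum>r<n. w r i * cnj (w r j))"
        by (auto simp: u_def)
      moreover have "i < n" "j < n"
        using False ij by auto
      ultimately show ?thesis
        using w by (simp add: g_def)
    qed
    then show ?thesis using last by simp
  qed
  then show ?case by blast
qed

lemma psd_factorization: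
  assumes "psd d F"
  shows "\<exists>w. \<forall>i<d. \<forall>j<d. F $$ (i, j) = (\<Sum>r<d. w r i * cnj (w r j))"
  by (rule quad_form_nonneg_factorization) (use assms in \<open>simp add: psd_iff_quad_form\<close>)

section \<open>Traces, scaling, transposes and rank-one examples of positive semi-definite
  matrices\<close>

lemma psd_carrier: "psd d A \<Longrightarrow> A \<in> carrier_mat d d"
  by (simp add: psd_def)

lemma psd_diag_nonneg:
  assumes "psd d A" "i < d"
  shows "0 \<le> A $$ (i, i)"
proof -
  have "0 \<le> quad_form d (\<lambda>i j. A $$ (i, j)) (\<lambda>k. if k = i then 1 else 0)"
    using assms(1) by (simp only: psd_iff_quad_form)
  then show ?thesis by (simp add: quad_form_point[OF assms(2)])
qed

lemma psd_trace_nonneg: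
  assumes "psd d A"
  shows "0 \<le> mat_trace A"
  using psd_diag_nonneg[OF assms] psd_carrier[OF assms]
  by (auto simp: mat_trace_def intro!: sum_nonneg)

text \<open>The diagonal entries are nonnegative with sum 0, and each is a sum of squared moduli of
  factor entries, so the whole factorization is 0. This disposes of the separable terms that cannot
  be normalised to trace one.\<close>

lemma psd_trace_zero:
  assumes A: "psd d A" and tr: "mat_trace A = 0"
  shows "A = 0\<^sub>m d d"
proof -
  obtain w where "\<forall>i<d. \<forall>j<d. A $$ (i, j) = (\<Sum>r<d. w r i * cnj (w r j))"
    using psd_factorization[OF A] ..
  then have w: "A $$ (i, j) = (\<Sum>r<d. w r i * cnj (w r j))" if "i < d" "j < d" for i j
    using that by simp
  have "\<forall>i\<in>{..<d}. A $$ (i, i) = 0"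
  proof (subst sum_nonneg_eq_0_iff[symmetric])
    show "(\<Sum>i<d. A $$ (i, i)) = 0"
      using tr psd_carrier[OF A] by (simp add: mat_trace_def)
  qed (use psd_diag_nonneg[OF A] in auto)
  then have diag: "(\<Sum>r<d. w r i * cnj (w r i)) = 0" if "i < d" for i
    using w[OF that that] that by simp
  have zero: "w r i = 0" if "i < d" "r < d" for i r
  proof -
    have "complex_of_real (\<Sum>r<d. (cmod (w r i))\<^sup>2) = 0"
      unfolding of_real_sum complex_norm_square using diag[OF that(1)] .
    then have "(\<Sum>r<d. (cmod (w r i))\<^sup>2) = 0"
      by (simp only: of_real_eq_0_iff)
    then have "\<forall>r\<in>{..<d}. (cmod (w r i))\<^sup>2 = 0"
      by (subst (asm) sum_nonneg_eq_0_iff) simp_all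
    then show ?thesis using that(2) by simp
  qed
  have "A $$ (i, j) = 0" if "i < d" "j < d" for i j
    unfolding w[OF that] using zero that by simp
  then show ?thesis
    using psd_carrier[OF A] by (intro eq_matI) simp_all
qed

lemma psd_smult:
  assumes "psd d A" "0 \<le> c"
  shows "psd d (c \<cdot>\<^sub>m A)"
proof -
  have "quad_form d (\<lambda>i j. (c \<cdot>\<^sub>m A) $$ (i, j)) x = c * quad_form d (\<lambda>i j. A $$ (i, j)) x" for x
    using psd_carrier[OF assms(1)] by (simp add: quad_form_def sum_distrib_left mult.assoc)
  then show ?thesis
    using assms by (auto simp: psd_iff_quad_form intro!: mult_nonneg_nonneg)
qed

text \<open>Exchanging the two indices of the form amounts to conjugating the test vector.\<close>

lemma psd_transpose:
  assumes "psd d A"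
  shows "psd d (transpose_mat A)"
proof -
  have "quad_form d (\<lambda>i j. transpose_mat A $$ (i, j)) x =
      quad_form d (\<lambda>i j. A $$ (i, j)) (\<lambda>i. cnj (x i))" for x
  proof -
    have "quad_form d (\<lambda>i j. transpose_mat A $$ (i, j)) x =
        (\<Sum>i<d. \<Sum>j<d. A $$ (j, i) * x j * cnj (x i))"
      using psd_carrier[OF assms] by (simp add: quad_form_def)
    also have "\<dots> = (\<Sum>j<d. \<Sum>i<d. A $$ (j, i) * x j * cnj (x i))"
      by (rule sum.swap)
    also have "\<dots> = quad_form d (\<lambda>i j. A $$ (i, j)) (\<lambda>i. cnj (x i))"
      by (simp add: quad_form_def ac_simps)
    finally show ?thesis .
  qed
  then show ?thesis
    using assms by (auto simp: psd_iff_quad_form)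
qed

lemma psd_ketbra:
  assumes "v \<in> carrier_vec d"
  shows "psd d (ketbra v)"
proof -
  have "0 \<le> quad_form d (\<lambda>i j. ketbra v $$ (i, j)) x" for x
  proof -
    \<comment> \<open>The form is a number times its own conjugate, hence a squared modulus.\<close>
    have "quad_form d (\<lambda>i j. ketbra v $$ (i, j)) x =
        (\<Sum>i<d. v $ i * cnj (x i)) * cnj (\<Sum>j<d. v $ j * cnj (x j))"
      using assms unfolding quad_form_def cnj_sum sum_product
      by (intro sum.cong refl) (simp add: ketbra_def)
    then show ?thesis
      unfolding complex_norm_square[symmetric] by (simp add: less_eq_complex_def)
  qed
  then show ?thesis
    using assms by (auto simp: psd_iff_quad_form ketbra_def)
qed

lemma mat_trace_ketbra:
  "mat_trace (ketbra v) = v \<bullet>c v"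
  by (simp add: mat_trace_def ketbra_def scalar_prod_def lessThan_atLeast0)

lemma density_matrix_ketbra:
  assumes "v \<in> carrier_vec d" "v \<bullet>c v = 1"
  shows "density_matrix d (ketbra v)"
  using assms by (simp add: density_matrix_def psd_ketbra mat_trace_ketbra)

section \<open>The trace pairing, matrix units and the expansion of linear maps\<close>

lemma mat_trace_mult:
  assumes "F \<in> carrier_mat d d" "G \<in> carrier_mat d d"
  shows "mat_trace (F * G) = (\<Sum>i<d. \<Sum>j<d. F $$ (i, j) * G $$ (j, i))"
  using assms by (simp add: mat_trace_def scalar_prod_def lessThan_atLeast0)

lemma mat_trace_ketbra_mult:
  assumes "v \<in> carrier_vec d" "\<rho> \<in> carrier_mat d d"
  shows "mat_trace (ketbra v * \<rho>) = (\<rho> *\<^sub>v v) \<bullet>c v"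
proof -
  have "ketbra v \<in> carrier_mat d d"
    using assms(1) by (simp add: ketbra_def)
  then have "mat_trace (ketbra v * \<rho>) = (\<Sum>j<d. \<Sum>i<d. ketbra v $$ (i, j) * \<rho> $$ (j, i))"
    by (subst sum.swap) (simp add: mat_trace_mult assms(2))
  also have "\<dots> = (\<rho> *\<^sub>v v) \<bullet>c v"
    using assms by (simp add: ketbra_def scalar_prod_def lessThan_atLeast0
        sum_distrib_left sum_distrib_right ac_simps)
  finally show ?thesis .
qed

lemma mat_family_sum_carrier [simp]: "mat_family_sum d m A \<in> carrier_mat d d"
  by (simp add: mat_family_sum_def)

lemma index_mat_family_sum [simp]:
  "i < d \<Longrightarrow> j < d \<Longrightarrow> mat_family_sum d m A $$ (i, j) = (\<Sum>k<m. A k $$ (i, j))"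
  "dim_row (mat_family_sum d m A) = d" "dim_col (mat_family_sum d m A) = d"
  by (simp_all add: mat_family_sum_def)

lemma mat_trace_mult_mat_family_sum:
  assumes "\<And>k. k < m \<Longrightarrow> F k \<in> carrier_mat d d" "\<rho> \<in> carrier_mat d d"
  shows "mat_trace (mat_family_sum d m F * \<rho>) = (\<Sum>k<m. mat_trace (F k * \<rho>))"
proof -
  have "mat_trace (mat_family_sum d m F * \<rho>) =
      (\<Sum>i<d. \<Sum>j<d. \<Sum>k<m. F k $$ (i, j) * \<rho> $$ (j, i))"
    by (simp add: mat_trace_mult[OF mat_family_sum_carrier assms(2)] sum_distrib_right)
  also have "\<dots> = (\<Sum>k<m. \<Sum>i<d. \<Sum>j<d. F k $$ (i, j) * \<rho> $$ (j, i))"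
    by (rule sum_rotate)
  finally show ?thesis
    by (simp add: mat_trace_mult[OF assms])
qed

definition mat_unit :: "nat \<Rightarrow> nat \<Rightarrow> nat \<Rightarrow> complex mat" where
  "mat_unit d a b = mat d d (\<lambda>(i, j). if i = a \<and> j = b then 1 else 0)"

lemma mat_unit_carrier [simp]: "mat_unit d a b \<in> carrier_mat d d"
  by (simp add: mat_unit_def)

lemma mat_trace_mult_unit:
  assumes "A \<in> carrier_mat d d" "a < d" "b < d"
  shows "mat_trace (A * mat_unit d b a) = A $$ (a, b)"
proof -
  have "mat_trace (A * mat_unit d b a) =
      (\<Sum>i<d. \<Sum>j<d. if j = b then if i = a then A $$ (i, j) else 0 else 0)"
    using assms unfolding mat_trace_mult[OF assms(1) mat_unit_carrier]
    by (intro sum.cong refl) (simp add: mat_unit_def)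
  then show ?thesis using assms by simp
qed

text \<open>The trace pairing is nondegenerate: testing against the matrix unit with transposed
  indices reads off a single entry.\<close>

lemma mat_trace_mult_eq_imp_eq:
  assumes "A \<in> carrier_mat d d" "B \<in> carrier_mat d d"
    and "\<And>\<rho>. \<rho> \<in> carrier_mat d d \<Longrightarrow> mat_trace (A * \<rho>) = mat_trace (B * \<rho>)"
  shows "A = B"
proof (rule eq_matI)
  fix a b assume "a < dim_row B" "b < dim_col B"
  then have "a < d" "b < d" using assms(2) by auto
  then show "A $$ (a, b) = B $$ (a, b)"
    using assms(3)[OF mat_unit_carrier, of b a]
    by (simp add: mat_trace_mult_unit[OF assms(1)] mat_trace_mult_unit[OF assms(2)])
qed (use assms in auto)

lemma linear_map_mat_family_sum:
  assumes \<Phi>: "linear_map d \<Phi>" and A: "\<And>k. k < m \<Longrightarrow> A k \<in> carrier_mat d d"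
  shows "\<Phi> (mat_family_sum d m A) = mat_family_sum d m (\<lambda>k. \<Phi> (A k))"
  using A
proof (induction m)
  case 0
  have z: "mat_family_sum d 0 B = 0\<^sub>m d d" for B
    by (intro eq_matI) auto
  \<comment> \<open>The empty family sums to the zero matrix, and \<open>\<Phi>\<close> sends zero
    to zero by homogeneity with the scalar 0.\<close>
  have "\<Phi> (0 \<cdot>\<^sub>m 0\<^sub>m d d) = 0 \<cdot>\<^sub>m \<Phi> (0\<^sub>m d d)" "\<Phi> (0\<^sub>m d d) \<in> carrier_mat d d"
    using \<Phi> zero_carrier_mat unfolding linear_map_def by blast+
  moreover from this(2) have "0 \<cdot>\<^sub>m \<Phi> (0\<^sub>m d d) = 0\<^sub>m d d"
    by (intro eq_matI) auto
  ultimately show ?case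
    by (simp add: z)
next
  case (Suc m)
  have step: "mat_family_sum d (Suc m) B = mat_family_sum d m B + B m"
    if "B m \<in> carrier_mat d d" for B
    using that by (intro eq_matI) auto
  have "\<Phi> (A m) \<in> carrier_mat d d"
    "\<Phi> (mat_family_sum d m A + A m) = \<Phi> (mat_family_sum d m A) + \<Phi> (A m)"
    using \<Phi> Suc.prems[of m] by (auto simp: linear_map_def)
  then show ?case
    using Suc by (simp add: step)
qed

lemma mat_eq_sum_mat_unit:
  assumes "\<rho> \<in> carrier_mat d d"
  shows "\<rho> = mat_family_sum d d (\<lambda>a. mat_family_sum d d (\<lambda>b. \<rho> $$ (a, b) \<cdot>\<^sub>m mat_unit d a b))"
    (is "_ = ?S")
proof (rule eq_matI)
  fix i j assume "i < dim_row ?S" "j < dim_col ?S"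
  then have ij: "i < d" "j < d" by simp_all
  then have "?S $$ (i, j) = (\<Sum>a<d. \<Sum>b<d. if b = j then if a = i then \<rho> $$ (a, b) else 0 else 0)"
    unfolding index_mat_family_sum(1)[OF ij] by (intro sum.cong refl) (simp add: mat_unit_def)
  then show "\<rho> $$ (i, j) = ?S $$ (i, j)"
    using ij by simp
qed (use assms in auto)

text \<open>Expanding \<open>\<rho>\<close> in matrix units shows that \<open>\<Phi>\<close> is
  determined by its values on them, which are the blocks of the Choi matrix up to scaling.\<close>

lemma linear_map_index:
  assumes \<Phi>: "linear_map d \<Phi>" and \<rho>: "\<rho> \<in> carrier_mat d d" and "i < d" "j < d"
  shows "\<Phi> \<rho> $$ (i, j) = (\<Sum>a<d. \<Sum>b<d. \<rho> $$ (a, b) * \<Phi> (mat_unit d a b) $$ (i, j))"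
proof -
  have carr: "\<Phi> (mat_unit d a b) \<in> carrier_mat d d"
    and smult: "\<Phi> (c \<cdot>\<^sub>m mat_unit d a b) = c \<cdot>\<^sub>m \<Phi> (mat_unit d a b)" for a b c
    using \<Phi> by (auto simp: linear_map_def)
  have "\<Phi> \<rho> = mat_family_sum d d
      (\<lambda>a. mat_family_sum d d (\<lambda>b. \<rho> $$ (a, b) \<cdot>\<^sub>m \<Phi> (mat_unit d a b)))"
    by (subst mat_eq_sum_mat_unit[OF \<rho>]) (simp add: linear_map_mat_family_sum[OF \<Phi>] smult)
  then show ?thesis
    using carr assms(3,4) by (simp add: carrier_matD[OF carr])
qed

section \<open>From the Holevo form to separability\<close>

lemma separable_ampliation_of_holevo_form:
  assumes hf: "holevo_form d \<Phi> m R F" and \<Gamma>: "psd (n * d) \<Gamma>"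
  shows "separable n d (ampliation n d \<Phi> \<Gamma>)"
proof -
  define P where "P k = mat n n (\<lambda>(a, b). mat_trace (F k * mat_block d \<Gamma> a b))" for k
  have R: "psd d (R k)" and F: "psd d (F k)" if "k < m" for k
    using hf that by (auto simp: holevo_form_def density_matrix_def)
  have block: "mat_block d \<Gamma> a b \<in> carrier_mat d d" for a b
    by (simp add: mat_block_def)
  have "psd n (P k)" if k: "k < m" for k
  proof -
    obtain w where w: "\<forall>i<d. \<forall>j<d. F k $$ (i, j) = (\<Sum>r<d. w r i * cnj (w r j))"
      using psd_factorization[OF F[OF k]] ..
    \<comment> \<open>Writing \<open>F k\<close> as the sum of the rank-one terms of
      \<open>w r\<close>, the form of \<open>P k\<close> at \<open>x\<close> becomes the sum over
      \<open>r\<close> of the forms of \<open>\<Gamma>\<close> at the product vectors of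
      \<open>x\<close> and \<open>w r\<close>.\<close>
    have "quad_form n (\<lambda>a b. P k $$ (a, b)) x =
        (\<Sum>r<d. quad_form (n * d) (\<lambda>i j. \<Gamma> $$ (i, j)) (\<lambda>i. x (i div d) * w r (i mod d)))" for x
    proof -
      have Pk: "P k $$ (a, b) = (\<Sum>j<d. \<Sum>i<d. \<Sum>r<d.
          w r j * cnj (w r i) * \<Gamma> $$ (a * d + i, b * d + j))" if "a < n" "b < n" for a b
      proof -
        have "P k $$ (a, b) = (\<Sum>j<d. \<Sum>i<d. F k $$ (j, i) * mat_block d \<Gamma> a b $$ (i, j))"
          using that by (simp add: P_def mat_trace_mult[OF psd_carrier[OF F[OF k]] block])
        then show ?thesis
          by (simp add: mat_block_def w sum_distrib_right)
      qed
      let ?h = "\<lambda>a b i j r. \<Gamma> $$ (a * d + i, b * d + j) * (x b * w r j) * cnj (x a * w r i)"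
      have "quad_form n (\<lambda>a b. P k $$ (a, b)) x =
          (\<Sum>a<n. \<Sum>b<n. \<Sum>j<d. \<Sum>i<d. \<Sum>r<d. ?h a b i j r)"
        by (simp add: quad_form_def Pk sum_distrib_left sum_distrib_right ac_simps)
      \<comment> \<open>The three rotations pair \<open>a\<close> with \<open>i\<close> and
        \<open>b\<close> with \<open>j\<close>, giving the row and column indices of
        \<open>\<Gamma>\<close>, and bring \<open>r\<close> to the outside.\<close>
      also have "\<dots> = (\<Sum>a<n. \<Sum>i<d. \<Sum>b<n. \<Sum>j<d. \<Sum>r<d. ?h a b i j r)"
        by (rule sum.cong[OF refl], rule sum_rotate)
      also have "\<dots> = (\<Sum>a<n. \<Sum>i<d. \<Sum>r<d. \<Sum>b<n. \<Sum>j<d. ?h a b i j r)"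
        by (rule sum.cong[OF refl], rule sum.cong[OF refl], rule sum_rotate)
      also have "\<dots> = (\<Sum>r<d. \<Sum>a<n. \<Sum>i<d. \<Sum>b<n. \<Sum>j<d. ?h a b i j r)"
        by (rule sum_rotate)
      also have "\<dots> = (\<Sum>r<d.
          quad_form (n * d) (\<lambda>i j. \<Gamma> $$ (i, j)) (\<lambda>i. x (i div d) * w r (i mod d)))"
        by (simp add: quad_form_def sum_mult_index)
      finally show ?thesis .
    qed
    moreover have "0 \<le> quad_form (n * d) (\<lambda>i j. \<Gamma> $$ (i, j)) y" for y
      using \<Gamma> by (simp add: psd_iff_quad_form)
    ultimately show ?thesis
      by (auto simp: psd_iff_quad_form P_def intro!: sum_nonneg)
  qed
  moreover have "ampliation n d \<Phi> \<Gamma> = mat_family_sum (n * d) m (\<lambda>k. kron (P k) (R k))"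
  proof (rule eq_matI)
    fix i j
    assume "i < dim_row (mat_family_sum (n * d) m (\<lambda>k. kron (P k) (R k)))"
      "j < dim_col (mat_family_sum (n * d) m (\<lambda>k. kron (P k) (R k)))"
    then have ij: "i < n * d" "j < n * d" by simp_all
    \<comment> \<open>For \<open>d = 0\<close> there would be no index below \<open>n * d\<close>;
      positivity of \<open>d\<close> is what bounds the remainders modulo \<open>d\<close>.\<close>
    then have "0 < d" by (cases d) auto
    then have mods: "i mod d < d" "j mod d < d" by simp_all
    have divs: "i div d < n" "j div d < n"
      using ij by (simp_all add: less_mult_imp_div_less)
    have dims: "dim_row (P k) = n" "dim_col (P k) = n" for k
      by (simp_all add: P_def)
    have Rdims: "dim_row (R k) = d" "dim_col (R k) = d" if "k < m" for k
      using psd_carrier[OF R[OF that]] by auto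
    let ?B = "mat_block d \<Gamma> (i div d) (j div d)"
    have "ampliation n d \<Phi> \<Gamma> $$ (i, j) = \<Phi> ?B $$ (i mod d, j mod d)"
      using ij by (simp add: ampliation_def)
    also have "\<Phi> ?B = mat_family_sum d m (\<lambda>k. mat_trace (F k * ?B) \<cdot>\<^sub>m R k)"
      using hf block unfolding holevo_form_def by blast
    also have "\<dots> $$ (i mod d, j mod d) =
        (\<Sum>k<m. mat_trace (F k * ?B) * R k $$ (i mod d, j mod d))"
      unfolding index_mat_family_sum(1)[OF mods] using mods Rdims by (intro sum.cong refl) simp
    also have "\<dots> = (\<Sum>k<m. kron (P k) (R k) $$ (i, j))"
    proof (intro sum.cong refl)
      fix k assume "k \<in> {..<m}"
      then have "kron (P k) (R k) $$ (i, j) =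
          P k $$ (i div d, j div d) * R k $$ (i mod d, j mod d)"
        using ij by (simp add: kron_def dims Rdims)
      also have "P k $$ (i div d, j div d) = mat_trace (F k * ?B)"
        using divs by (simp add: P_def)
      finally show "mat_trace (F k * ?B) * R k $$ (i mod d, j mod d) = kron (P k) (R k) $$ (i, j)"
        by (rule sym)
    qed
    finally show "ampliation n d \<Phi> \<Gamma> $$ (i, j) = mat_family_sum (n * d) m (\<lambda>k. kron (P k) (R k)) $$ (i, j)"
      by (simp only: index_mat_family_sum(1)[OF ij])
  qed (simp_all add: ampliation_def)
  ultimately show ?thesis
    unfolding separable_def using R by (intro exI[of _ m] exI[of _ P] exI[of _ R]) simp
qed

section \<open>From a separable Choi matrix to the Holevo form\<close>

text \<open>The projector onto the maximally entangled vector, whose image is the Choi matrix.\<close>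

definition max_entangled :: "nat \<Rightarrow> complex mat" where
  "max_entangled d = (1 / of_nat d) \<cdot>\<^sub>m ketbra (vec (d * d) (\<lambda>i. if i div d = i mod d then 1 else 0))"

lemma density_matrix_max_entangled:
  assumes "d \<ge> 1"
  shows "density_matrix (d * d) (max_entangled d)"
proof -
  have "mat_trace (max_entangled d) =
      (\<Sum>i<d * d. if i div d = i mod d then 1 / of_nat d else 0)"
    by (auto simp: mat_trace_def max_entangled_def ketbra_def intro!: sum.cong)
  also have "\<dots> = (\<Sum>a<d. \<Sum>k<d. if a = k then 1 / of_nat d else 0)"
    by (auto simp: sum_mult_index intro!: sum.cong)
  also have "\<dots> = 1"
    using assms by simp
  finally have "mat_trace (max_entangled d) = 1" .
  moreover have "psd (d * d) (max_entangled d)"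
    unfolding max_entangled_def
    by (intro psd_smult psd_ketbra) (auto simp: less_eq_complex_def)
  ultimately show ?thesis
    by (simp add: density_matrix_def)
qed

text \<open>The unnormalised vector is the sum of all \<open>e_a\<close> tensor \<open>e_a\<close>,
  so block \<open>(a, b)\<close> of its projector has its only nonzero entry at
  \<open>(a, b)\<close>. Applying \<open>\<Phi>\<close> blockwise thus lists its values on the
  matrix units.\<close>

lemma mat_block_max_entangled:
  assumes "a < d" "b < d"
  shows "mat_block d (max_entangled d) a b = (1 / of_nat d) \<cdot>\<^sub>m mat_unit d a b"
  using assms mult_add_less
  by (intro eq_matI) (auto simp: mat_block_def max_entangled_def ketbra_def mat_unit_def)

lemma holevo_form_of_separable_choi:
  assumes d: "d \<ge> 1" and \<Phi>: "linear_map d \<Phi>"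
    and sep: "separable d d (ampliation d d \<Phi> (max_entangled d))"
  shows "\<exists>m R F. holevo_form d \<Phi> m R F"
proof -
  obtain m P Q where P: "\<And>k. k < m \<Longrightarrow> psd d (P k)" and Q: "\<And>k. k < m \<Longrightarrow> psd d (Q k)"
    and eq: "ampliation d d \<Phi> (max_entangled d) = mat_family_sum (d * d) m (\<lambda>k. kron (P k) (Q k))"
    using sep unfolding separable_def by blast
  \<comment> \<open>Comparing the entries at \<open>(a * d + i, b * d + j)\<close> in
    \<open>eq\<close> separates the two tensor factors; the factor \<open>d\<close> undoes the
    normalisation of the state.\<close>
  have unit: "\<Phi> (mat_unit d a b) $$ (i, j) = of_nat d * (\<Sum>k<m. P k $$ (a, b) * Q k $$ (i, j))"
    if "a < d" "b < d" "i < d" "j < d" for a b i j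
  proof -
    have "\<Phi> ((1 / of_nat d) \<cdot>\<^sub>m mat_unit d a b) = (1 / of_nat d) \<cdot>\<^sub>m \<Phi> (mat_unit d a b)"
      "\<Phi> (mat_unit d a b) \<in> carrier_mat d d"
      using \<Phi> by (auto simp: linear_map_def)
    then have "ampliation d d \<Phi> (max_entangled d) $$ (a * d + i, b * d + j) =
        \<Phi> (mat_unit d a b) $$ (i, j) / of_nat d"
      using that mult_add_less by (simp add: ampliation_def mat_block_max_entangled)
    moreover have "kron (P k) (Q k) $$ (a * d + i, b * d + j) = P k $$ (a, b) * Q k $$ (i, j)"
      if "k < m" for k
      using psd_carrier[OF P[OF that]] psd_carrier[OF Q[OF that]] \<open>a < d\<close> \<open>b < d\<close> \<open>i < d\<close> \<open>j < d\<close>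
        mult_add_less
      by (auto simp: kron_def)
    ultimately show ?thesis
      using d that mult_add_less by (simp add: eq field_simps)
  qed
  \<comment> \<open>A trace-zero \<open>Q k\<close> is the zero matrix and makes \<open>F k\<close>
    zero as well, so any density matrix may stand in for it; the basis projector used here exists
    because \<open>d \<ge> 1\<close>.\<close>
  define R where "R k = (if mat_trace (Q k) = 0 then ketbra (unit_vec d 0)
    else (1 / mat_trace (Q k)) \<cdot>\<^sub>m Q k)" for k
  \<comment> \<open>\<open>F k\<close> absorbs the factor \<open>d\<close> and the trace divided out
    of \<open>Q k\<close>. The transpose turns the sum of
    \<open>P k $$ (a, b) * \<rho> $$ (a, b)\<close> into a trace pairing with
    \<open>\<rho>\<close>.\<close>
  define F where "F k = (of_nat d * mat_trace (Q k)) \<cdot>\<^sub>m transpose_mat (P k)" for k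
  have tr: "0 \<le> mat_trace (Q k)" if "k < m" for k
    using psd_trace_nonneg[OF Q[OF that]] .
  have FR: "of_nat d * (P k $$ (a, b) * Q k $$ (i, j)) = F k $$ (b, a) * R k $$ (i, j)"
    if "k < m" "a < d" "b < d" "i < d" "j < d" for k a b i j
    using psd_carrier[OF P[OF that(1)]] psd_carrier[OF Q[OF that(1)]] psd_trace_zero[OF Q[OF that(1)]] that
    by (auto simp: F_def R_def)
  have F: "psd d (F k)" if "k < m" for k
    unfolding F_def using P[OF that] tr[OF that]
    by (intro psd_smult psd_transpose) (auto simp: less_eq_complex_def)
  have R: "density_matrix d (R k)" if k: "k < m" for k
  proof (cases "mat_trace (Q k) = 0")
    case True
    then show ?thesis
      using d by (simp add: R_def density_matrix_ketbra)
  next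
    case False
    have "mat_trace ((1 / mat_trace (Q k)) \<cdot>\<^sub>m Q k) = (1 / mat_trace (Q k)) * mat_trace (Q k)"
      using psd_carrier[OF Q[OF k]]
      by (simp add: mat_trace_def[of "_ \<cdot>\<^sub>m _"]) (simp add: mat_trace_def flip: sum_divide_distrib)
    moreover have "0 \<le> 1 / mat_trace (Q k)"
      using tr[OF k] by (simp add: less_eq_complex_def Re_divide Im_divide)
    ultimately show ?thesis
      using False psd_smult[OF Q[OF k]] by (simp add: R_def density_matrix_def)
  qed
  have "\<Phi> \<rho> = mat_family_sum d m (\<lambda>k. mat_trace (F k * \<rho>) \<cdot>\<^sub>m R k)"
    if \<rho>: "\<rho> \<in> carrier_mat d d" for \<rho>
  proof (rule eq_matI)
    fix i j
    assume "i < dim_row (mat_family_sum d m (\<lambda>k. mat_trace (F k * \<rho>) \<cdot>\<^sub>m R k))"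
      "j < dim_col (mat_family_sum d m (\<lambda>k. mat_trace (F k * \<rho>) \<cdot>\<^sub>m R k))"
    then have ij: "i < d" "j < d" by simp_all
    have Rdims: "dim_row (R k) = d" "dim_col (R k) = d" if "k < m" for k
      using psd_carrier[of d "R k"] R[OF that] by (auto simp: density_matrix_def)
    have "\<Phi> \<rho> $$ (i, j) = (\<Sum>a<d. \<Sum>b<d. \<Sum>k<m. F k $$ (b, a) * \<rho> $$ (a, b) * R k $$ (i, j))"
      using ij by (simp add: linear_map_index[OF \<Phi> \<rho>] unit FR sum_distrib_left ac_simps)
    also have "\<dots> = (\<Sum>k<m. \<Sum>b<d. \<Sum>a<d. F k $$ (b, a) * \<rho> $$ (a, b) * R k $$ (i, j))"
      by (subst sum.swap) (rule sum_rotate)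
    also have "\<dots> = (\<Sum>k<m. mat_trace (F k * \<rho>) * R k $$ (i, j))"
      by (simp add: mat_trace_mult[OF psd_carrier[OF F] \<rho>] sum_distrib_right)
    finally show "\<Phi> \<rho> $$ (i, j) = mat_family_sum d m (\<lambda>k. mat_trace (F k * \<rho>) \<cdot>\<^sub>m R k) $$ (i, j)"
      using ij by (simp add: Rdims)
  qed (use \<Phi> \<rho> in \<open>auto simp: linear_map_def\<close>)
  then show ?thesis
    using R F unfolding holevo_form_def by blast
qed

section \<open>Trace preservation and the rank-one form\<close>

lemma holevo_form_trace_preserving_iff:
  assumes hf: "holevo_form d \<Phi> m R F"
  shows "trace_preserving d \<Phi> \<longleftrightarrow> povm d m F"
proof -
  have F: "psd d (F k)" and R: "R k \<in> carrier_mat d d" "(\<Sum>i<d. R k $$ (i, i)) = 1" if "k < m" for k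
    using hf that psd_carrier[of d "R k"]
    by (auto simp: holevo_form_def density_matrix_def mat_trace_def)
  have Rdims: "dim_row (R k) = d" "dim_col (R k) = d" if "k < m" for k
    using R(1)[OF that] by auto
  \<comment> \<open>Each \<open>R k\<close> has trace one, so only the coefficients survive under
    the trace, and they add up to the pairing of \<open>\<rho>\<close> with the sum of the
    \<open>F k\<close>.\<close>
  have tr: "mat_trace (\<Phi> \<rho>) = mat_trace (mat_family_sum d m F * \<rho>)" if \<rho>: "\<rho> \<in> carrier_mat d d" for \<rho>
  proof -
    have "mat_trace (\<Phi> \<rho>) = (\<Sum>i<d. \<Sum>k<m. mat_trace (F k * \<rho>) * R k $$ (i, i))"
      using hf \<rho> by (simp add: holevo_form_def mat_trace_def[of "mat_family_sum _ _ _"] Rdims)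
    also have "\<dots> = (\<Sum>k<m. mat_trace (F k * \<rho>) * (\<Sum>i<d. R k $$ (i, i)))"
      by (subst sum.swap) (simp add: sum_distrib_left)
    finally show ?thesis
      using R(2) F \<rho> by (simp add: mat_trace_mult_mat_family_sum psd_carrier)
  qed
  have "trace_preserving d \<Phi> \<longleftrightarrow>
      (\<forall>\<rho> \<in> carrier_mat d d. mat_trace (mat_family_sum d m F * \<rho>) = mat_trace (1\<^sub>m d * \<rho>))"
    by (simp add: trace_preserving_def tr)
  also have "\<dots> \<longleftrightarrow> mat_family_sum d m F = 1\<^sub>m d"
    using mat_trace_mult_eq_imp_eq[OF mat_family_sum_carrier one_carrier_mat] by metis
  finally show ?thesis
    using F by (simp add: povm_def)
qed

text \<open>The coefficient \<open>(\<rho> *\<^sub>v \<phi> k) \<bullet>c \<phi> k\<close> is a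
  trace pairing with \<open>ketbra (\<phi> k)\<close>, and unit vectors give density matrices. The
  trace criterion therefore carries over.\<close>

lemma rank_one_form_imp_holevo_form:
  assumes "rank_one_form d \<Phi> m \<psi> \<phi>"
  shows "holevo_form d \<Phi> m (\<lambda>k. ketbra (\<psi> k)) (\<lambda>k. ketbra (\<phi> k))"
proof -
  have "mat_family_sum d m (\<lambda>k. ((\<rho> *\<^sub>v \<phi> k) \<bullet>c \<phi> k) \<cdot>\<^sub>m ketbra (\<psi> k)) =
      mat_family_sum d m (\<lambda>k. mat_trace (ketbra (\<phi> k) * \<rho>) \<cdot>\<^sub>m ketbra (\<psi> k))"
    if "\<rho> \<in> carrier_mat d d" for \<rho>
    using assms that
    by (auto simp: mat_family_sum_def rank_one_form_def mat_trace_ketbra_mult intro!: cong_mat sum.cong)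
  then show ?thesis
    using assms by (simp add: rank_one_form_def holevo_form_def density_matrix_ketbra psd_ketbra)
qed

theorem theorem2:
  fixes d :: nat and \<Phi> :: "complex mat \<Rightarrow> complex mat"
  assumes "d \<ge> 1"
    and "completely_positive d \<Phi>"
  shows "((\<exists>m R F. holevo_form d \<Phi> m R F) \<longleftrightarrow> entanglement_breaking d \<Phi>) \<and>
    (\<forall>m R F. holevo_form d \<Phi> m R F \<longrightarrow> (trace_preserving d \<Phi> \<longleftrightarrow> povm d m F)) \<and>
    (\<forall>m \<psi> \<phi>. rank_one_form d \<Phi> m \<psi> \<phi> \<longrightarrow>
       (trace_preserving d \<Phi> \<longleftrightarrow> mat_family_sum d m (\<lambda>k. ketbra (\<phi> k)) = 1\<^sub>m d))"
proof (intro conjI allI impI)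
  have lin: "linear_map d \<Phi>"
    using assms(2) by (simp add: completely_positive_def)
  \<comment> \<open>Entanglement breaking is applied with \<open>n = d\<close> to the maximally
    entangled state; in the other direction only positivity of the density matrix enters.\<close>
  show "(\<exists>m R F. holevo_form d \<Phi> m R F) \<longleftrightarrow> entanglement_breaking d \<Phi>"
    using separable_ampliation_of_holevo_form holevo_form_of_separable_choi[OF assms(1) lin]
      density_matrix_max_entangled[OF assms(1)] assms(1)
    unfolding entanglement_breaking_def density_matrix_def by blast
  show "trace_preserving d \<Phi> \<longleftrightarrow> povm d m F" if "holevo_form d \<Phi> m R F" for m R F
    using holevo_form_trace_preserving_iff[OF that] .
  \<comment> \<open>The positivity part of \<open>povm\<close> holds automatically for the
    \<open>ketbra (\<phi> k)\<close>, which leaves the equation for their sum.\<close>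
  show "trace_preserving d \<Phi> \<longleftrightarrow> mat_family_sum d m (\<lambda>k. ketbra (\<phi> k)) = 1\<^sub>m d"
    if rf: "rank_one_form d \<Phi> m \<psi> \<phi>" for m \<psi> \<phi>
    using holevo_form_trace_preserving_iff[OF rank_one_form_imp_holevo_form[OF rf]] rf
    by (simp add: povm_def rank_one_form_def psd_ketbra)
qed

end
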